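(* Let $m\in\mathbb{Z}$ and let $p$ be a prime divisor of $4m-1$. Then $$\nu_p\left(\sum_{k=0}^{n-1}\binom{2k}{k}m^k\right)\geq\nu_p(n)$$ for all $n\in\mathbb{Z}^+$.
   Context: $\mathbb{Z}^+=\{1,2,3,\ldots\}$. For a prime $p$ and an integer $x$, $\nu_p(x)=\sup\{a\in\mathbb{Z}: p^a\mid x\}$ (so $\nu_p(0)=+\infty$). *)

theory Defs
  imports "HOL-Computational_Algebra.Primes" "HOL-Library.Extended_Nat"
begin

(* The exponents a range over the naturals: a = 0 always qualifies, so negative exponents
   do not affect the supremum. Unlike the library's multiplicity, which is 0 at 0,
   the value at x = 0 is infinity. *)
definition padic_val :: "nat \<Rightarrow> int \<Rightarrow> enat" where
  "padic_val p x = Sup {enat a | a. int p ^ a dvd x}"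

end

theory Submission
  imports Defs
begin

text \<open>
  Put \<open>d = 4 * m - 1\<close> and \<open>N = n - 1\<close>. Expanding \<open>(4 * m) ^ k = (1 + d) ^ k\<close> turns
  \<open>4 ^ N\<close> times the sum into \<open>\<Sum>j\<le>N. d ^ j * V j\<close>, where the integer
  \<open>V j = (\<Sum>k\<le>N. (2 * k choose k) * 4 ^ (N - k) * (k choose j))\<close> has the closed form
  \<open>2 * (2 * j + 1) * V j = n * (2 * n choose n) * (N choose j)\<close>.
  As \<open>p\<close> is odd, \<open>2 * j + 1 \<le> 3 ^ j \<le> p ^ j\<close>, so the factor \<open>d ^ j\<close> makes up for the
  powers of \<open>p\<close> in \<open>2 * j + 1\<close>, and each term inherits every power of \<open>p\<close> dividing \<open>n\<close>.
\<close>

text \<open>Absorption, symmetry, then absorption again. It drives the induction below and later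
  exposes the factor \<open>Suc n\<close>.\<close>

lemma central_binomial_Suc:
  "Suc n * (2 * Suc n choose Suc n) = 2 * (2 * n + 1) * (2 * n choose n)"
proof -
  have "Suc n * (2 * Suc n choose Suc n) = 2 * Suc n * (Suc (2 * n) choose n)"
    using Suc_times_binomial_eq[of "Suc (2 * n)" n] by (simp add: mult.commute)
  also have "Suc (2 * n) choose n = Suc (2 * n) choose Suc n"
    using binomial_symmetric[of n "Suc (2 * n)"] by (simp add: Suc_diff_le)
  also have "2 * Suc n * (Suc (2 * n) choose Suc n) = 2 * (2 * n + 1) * (2 * n choose n)"
    using Suc_times_binomial_eq[of "2 * n" n] by (simp add: algebra_simps)
  finally show ?thesis .
qed

text \<open>Induction on \<open>n\<close>: the sum satisfies
  \<open>V (Suc n) = 4 * V n + C' * B'\<close>, and rewriting \<open>C\<close> and \<open>B\<close>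
  through \<open>C'\<close> and \<open>B'\<close> leaves the identity
  \<open>2 * (n + 1 - j) + (2 * j + 1) = 2 * n + 3\<close>.\<close>

lemma sum_central_binomial_choose:
  "(2 * int j + 1) * (\<Sum>k\<le>n. int (2 * k choose k) * 4 ^ (n - k) * int (k choose j))
     = (2 * int n + 1) * int (2 * n choose n) * int (n choose j)"
proof (induction n)
  case 0
  then show ?case by (cases j) auto
next
  case (Suc n)
  define V where "V = (\<lambda>n. \<Sum>k\<le>n. int (2 * k choose k) * 4 ^ (n - k) * int (k choose j))"
  define C where "C = int (2 * n choose n)"
  define C' where "C' = int (2 * Suc n choose Suc n)"
  define B where "B = int (n choose j)"
  define B' where "B' = int (Suc n choose j)"
  have V: "V (Suc n) = 4 * V n + C' * B'"
    by (auto simp: V_def C'_def B'_def sum_distrib_left Suc_diff_le intro!: sum.cong)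
  have C: "(int n + 1) * C' = 2 * (2 * int n + 1) * C"
    using arg_cong[OF central_binomial_Suc[of n], of int] unfolding C_def C'_def
    by (simp only: of_nat_mult of_nat_add of_nat_Suc of_nat_numeral of_nat_1 add.commute)
  have B: "(int n + 1) * B = (int n + 1 - int j) * B'"
  \<comment> \<open>For \<open>j > Suc n\<close> the integer \<open>n + 1 - j\<close> is negative,
    but both binomials vanish.\<close>
  proof (cases "j \<le> Suc n")
    case True
    have "int (Suc n - j) * B' = int (Suc n) * B"
      using arg_cong[OF binomial_absorb_comp[of "Suc n" j], of int]
      by (simp only: B_def B'_def of_nat_mult diff_Suc_1)
    with True show ?thesis by (simp add: of_nat_diff add.commute)
  qed (simp add: B_def B'_def binomial_eq_0)
  have "(2 * int j + 1) * V (Suc n)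
      = 4 * ((2 * int j + 1) * V n) + (2 * int j + 1) * (C' * B')"
    unfolding V by (simp add: algebra_simps)
  also have "(2 * int j + 1) * V n = (2 * int n + 1) * C * B"
    using Suc.IH unfolding V_def C_def B_def .
  also have "4 * ((2 * int n + 1) * C * B) = 2 * ((int n + 1) * B) * C'"
    using C by algebra
  also have "\<dots> + (2 * int j + 1) * (C' * B') = (2 * int n + 3) * C' * B'"
    unfolding B by (simp add: algebra_simps)
  finally show ?case unfolding V_def C'_def B'_def by (simp add: add.commute)
qed

lemma sum_central_binomial_expansion:
  "4 ^ n * (\<Sum>k\<le>n. int (2 * k choose k) * m ^ k)
     = (\<Sum>j\<le>n. (4 * m - 1) ^ j *
         (\<Sum>k\<le>n. int (2 * k choose k) * 4 ^ (n - k) * int (k choose j)))"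
proof -
  have pow: "(4 * m) ^ k = (\<Sum>j\<le>n. int (k choose j) * (4 * m - 1) ^ j)" if "k \<le> n" for k
  proof -
    have "(4 * m) ^ k = (\<Sum>j\<le>k. int (k choose j) * (4 * m - 1) ^ j)"
      using binomial_ring[of "4 * m - 1" 1 k] by simp
    \<comment> \<open>The added terms have \<open>j > k\<close> and vanish; a range independent of
      \<open>k\<close> lets the two sums be swapped later.\<close>
    also have "\<dots> = (\<Sum>j\<le>n. int (k choose j) * (4 * m - 1) ^ j)"
      using that by (intro sum.mono_neutral_left) auto
    finally show ?thesis .
  qed
  have "4 ^ n * (\<Sum>k\<le>n. int (2 * k choose k) * m ^ k)
      = (\<Sum>k\<le>n. int (2 * k choose k) * 4 ^ (n - k) * (4 * m) ^ k)"
    unfolding sum_distrib_left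
  proof (intro sum.cong refl)
    fix k assume "k \<in> {..n}"
    then have "(4 :: int) ^ n = 4 ^ (n - k) * 4 ^ k" by (simp flip: power_add)
    then show "4 ^ n * (int (2 * k choose k) * m ^ k)
        = int (2 * k choose k) * 4 ^ (n - k) * (4 * m) ^ k"
      by (simp add: power_mult_distrib)
  qed
  also have "\<dots> = (\<Sum>k\<le>n. \<Sum>j\<le>n. (4 * m - 1) ^ j *
      (int (2 * k choose k) * 4 ^ (n - k) * int (k choose j)))"
    by (intro sum.cong refl, subst pow) (simp_all add: sum_distrib_left mult_ac)
  also have "\<dots> = (\<Sum>j\<le>n. (4 * m - 1) ^ j *
      (\<Sum>k\<le>n. int (2 * k choose k) * 4 ^ (n - k) * int (k choose j)))"
    by (subst sum.swap) (simp add: sum_distrib_left)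
  finally show ?thesis .
qed

lemma prime_power_dvd_odd_le:
  fixes p :: nat
  assumes "p \<ge> 3" and "p ^ e dvd 2 * j + 1"
  shows "e \<le> j"
proof -
  have "2 * j + 1 \<le> 3 ^ j" by (induction j) auto
  also have "\<dots> \<le> p ^ j" using assms(1) by (rule power_mono) simp
  finally have "p ^ e \<le> p ^ j" using dvd_imp_le[OF assms(2)] by simp
  with assms(1) show ?thesis by (simp add: power_le_imp_le_exp)
qed

lemma prime_power_dvd_sum_central_binomial:
  fixes m :: int and p n :: nat
  assumes p: "prime p" and d: "int p dvd 4 * m - 1" and n: "int p ^ a dvd int (Suc n)"
  shows "int p ^ a dvd (\<Sum>k\<le>n. int (2 * k choose k) * m ^ k)"
proof -
  have "odd p"
  proof
    assume "even p"
    then have "even (4 * m - 1)" using d by (meson dvd_trans even_of_nat)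
    then show False by simp
  qed
  with prime_ge_2_nat[OF p] have p3: "p \<ge> 3" by (cases "p = 2") auto
  have p': "prime (int p)" using p by simp
  have two: "coprime (int p ^ a) 2" using \<open>odd p\<close> by simp
  have "int p ^ a dvd (4 * m - 1) ^ j *
      (\<Sum>k\<le>n. int (2 * k choose k) * 4 ^ (n - k) * int (k choose j))"
    (is "_ dvd _ * ?V") for j
  proof -
    \<comment> \<open>The extra factor 2 completes the right-hand side of
      \<open>central_binomial_Suc\<close>, which then supplies \<open>Suc n\<close>.\<close>
    have "2 * ((2 * int j + 1) * ?V)
        = int (2 * (2 * n + 1) * (2 * n choose n)) * int (n choose j)"
      unfolding sum_central_binomial_choose by (simp add: algebra_simps)
    also have "\<dots> = int (Suc n) * int ((2 * Suc n choose Suc n) * (n choose j))"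
      unfolding central_binomial_Suc[symmetric] by (simp only: of_nat_mult mult.assoc)
    finally have "int p ^ a dvd 2 * ((2 * int j + 1) * ?V)"
      using n by (simp only: dvd_mult2)
    then have dvd: "int p ^ a dvd (2 * int j + 1) * ?V"
      using two by (simp add: coprime_dvd_mult_right_iff)
    \<comment> \<open>The cofactor \<open>q\<close> is coprime to \<open>p\<close> and cancels; only
      \<open>p ^ e\<close> must be absorbed, and since \<open>e \<le> j\<close> it divides
      \<open>(4 * m - 1) ^ j\<close>.\<close>
    obtain e q where e: "2 * j + 1 = p ^ e * q" "\<not> p dvd q"
    proof -
      have "2 * j + 1 \<noteq> 0" "\<not> is_unit p" using p not_prime_unit by auto
      then show ?thesis using that by (metis multiplicity_decompose')
    qed
    have "coprime (int p ^ a) (int q)"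
      using e(2) p' by (simp add: prime_imp_coprime)
    moreover have "(2 * int j + 1) * ?V = int q * (int p ^ e * ?V)"
      using arg_cong[OF e(1), of int] by (simp add: mult_ac)
    ultimately have "int p ^ a dvd int p ^ e * ?V"
      using dvd by (simp only: coprime_dvd_mult_right_iff)
    moreover have "int p ^ e dvd (4 * m - 1) ^ j"
    proof -
      have "e \<le> j" using prime_power_dvd_odd_le[OF p3, of e j] e(1) by simp
      then show ?thesis
        using d by (meson dvd_trans dvd_power_same le_imp_power_dvd)
    qed
    ultimately show ?thesis by (meson dvd_trans dvd_refl mult_dvd_mono)
  qed
  then have "int p ^ a dvd 4 ^ n * (\<Sum>k\<le>n. int (2 * k choose k) * m ^ k)"
    unfolding sum_central_binomial_expansion by (intro dvd_sum)
  moreover have "coprime (int p ^ a) (4 ^ n)"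
    using \<open>odd p\<close> coprime_power_right_iff[of "int p ^ a" 2 "2 * n"] by (simp add: power_mult)
  ultimately show ?thesis by (simp add: coprime_dvd_mult_right_iff)
qed

theorem corollary1p1:
  fixes m :: int and p n :: nat
  assumes "prime p" and "int p dvd 4 * m - 1" and "n \<ge> 1"
  shows "padic_val p (\<Sum>k = 0..n - 1. int ((2 * k) choose k) * m ^ k) \<ge> padic_val p (int n)"
proof -
  have "int p ^ a dvd (\<Sum>k = 0..n - 1. int ((2 * k) choose k) * m ^ k)"
    if "int p ^ a dvd int n" for a
    using prime_power_dvd_sum_central_binomial[OF assms(1,2), of a "n - 1"] that assms(3)
    by (simp add: atMost_atLeast0)
  \<comment> \<open>Inclusion of the exponent sets suffices, so a zero sum, with infinite valuation,
    needs no separate case.\<close>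
  then show ?thesis unfolding padic_val_def by (intro Sup_subset_mono) auto
qed

end
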